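(* Let $M=(\mathcal{X},\mathcal{B},\{P_{\theta,X}:\theta\in\Theta\})$ be a statistical model all of whose ancillary statistics are discretely distributed on $\mathbb{N}$ and which has at most countably many ancillary statistics. Then: (i) An ancillary statistic for $M$ is a stable (equivalently, strong) ancillary if and only if it is a minimal ancillary. (ii) There exists a maximal minimal ancillary for $M$, i.e. a minimal ancillary that is maximal in the class of minimal ancillaries (the laminal ancillary).
   Context: A statistical model $M=(\mathcal{X},\mathcal{B},\{P_{\theta,X}:\theta\in\Theta\})$ consists of a sample space $\mathcal{X}$, a $\sigma$-algebra $\mathcal{B}$ on $\mathcal{X}$, and a family of probability measures $P_{\theta,X}$ on $\mathcal{B}$ indexed by $\theta\in\Theta$. An ancillary statistic for $M$ is a measurable map $A:(\mathcal{X},\mathcal{B})\to(\mathcal{A},\mathcal{C})$ whose induced marginal probability measure $P_{\theta,A}$ does not depend on $\theta$; write $P_A$ for this common measure. Ancillaries that are 1-1 functions (relabellings) of each other are regarded as the same. Standing assumption: every ancillary (including any ancillary formed by combining countably many ancillaries into one statistic) is, after relabelling, $\mathbb{N}$-valued, and there are at most countably many ancillaries (up to relabelling). An ancillary $A$ is a maximal ancillary if, whenever $A'$ is another ancillary and there is a function $h$ with $A=h(A')$, then $h$ is 1-1 (on the range of $A'$). A minimal ancillary is an ancillary that is a function of every maximal ancillary. A minimal ancillary $A$ is maximal in the class of minimal ancillaries if, whenever $A'$ is a minimal ancillary and $A=h(A')$ for a function $h$, then $h$ is 1-1 (on the range of $A'$). For an ancillary $V$ and a possible value $i$ of $V$ (that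 is, $P_V(\{i\})>0$), $M_{|V=i}$ denotes the conditional model $\{P_{\theta,X}(\cdot\,|\,V=i):\theta\in\Theta\}$ on $(\mathcal{X},\mathcal{B})$. For a probability distribution $(p_1,p_2,\ldots)$ on the set of possible values of $V$, the mixture $\sum_i p_i M_{|V=i}$ is the model $\{\sum_i p_i P_{\theta,X}(\cdot\,|\,V=i):\theta\in\Theta\}$ on $(\mathcal{X},\mathcal{B})$. An ancillary $U$ for $M$ is a stable ancillary for $M$ if, whenever $V$ is ancillary for $M$, $U$ is ancillary for the mixture $\sum_i p_i M_{|V=i}$ for every probability distribution $(p_1,p_2,\ldots)$ on the set of possible values of $V$. An ancillary $U$ for $M$ is a strong ancillary for $M$ if every ancillary $V$ for $M$ is also ancillary for the mixture $\sum_i p_i M_{|U=i}$ for every probability distribution $(p_1,p_2,\ldots)$ on the set of possible values of $U$. (An ancillary is strong if and only if it is stable.) *)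

theory Defs
  imports "HOL-Probability.Probability"
begin

text \<open>A statistical model is given by a measurable space \<open>X\<close> (only \<open>space X\<close> and \<open>sets X\<close>
  matter), a parameter set \<open>\<Theta>\<close> and a family \<open>P\<close> of probability measures on \<open>X\<close>.\<close>

definition statistical_model :: "'x measure \<Rightarrow> 't set \<Rightarrow> ('t \<Rightarrow> 'x measure) \<Rightarrow> bool" where
  "statistical_model X \<Theta> P \<longleftrightarrow>
     \<Theta> \<noteq> {} \<and> (\<forall>\<theta>\<in>\<Theta>. prob_space (P \<theta>) \<and> sets (P \<theta>) = sets X)"

definition ancillary_into ::
  "'x measure \<Rightarrow> 't set \<Rightarrow> ('t \<Rightarrow> 'x measure) \<Rightarrow> 'a measure \<Rightarrow> ('x \<Rightarrow> 'a) \<Rightarrow> bool" where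
  "ancillary_into X \<Theta> P C A \<longleftrightarrow>
     A \<in> measurable X C \<and> (\<exists>Q. \<forall>\<theta>\<in>\<Theta>. distr (P \<theta>) C A = Q)"

text \<open>Ancillaries are considered up to relabelling, and all of them are assumed to be discrete, so
  the notions below are stated for ancillaries with values in \<open>nat\<close>.\<close>

abbreviation ancillary ::
  "'x measure \<Rightarrow> 't set \<Rightarrow> ('t \<Rightarrow> 'x measure) \<Rightarrow> ('x \<Rightarrow> nat) \<Rightarrow> bool" where
  "ancillary X \<Theta> P A \<equiv> ancillary_into X \<Theta> P (count_space UNIV) A"

text \<open>Functional dependence is pointwise on the sample space, not almost sure.\<close>

definition is_function_via :: "'x measure \<Rightarrow> ('b \<Rightarrow> 'a) \<Rightarrow> ('x \<Rightarrow> 'a) \<Rightarrow> ('x \<Rightarrow> 'b) \<Rightarrow> bool" where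
  "is_function_via X h A B \<longleftrightarrow> (\<forall>x\<in>space X. A x = h (B x))"

definition relabelling :: "'x measure \<Rightarrow> ('x \<Rightarrow> 'a) \<Rightarrow> ('x \<Rightarrow> 'b) \<Rightarrow> bool" where
  "relabelling X A B \<longleftrightarrow> (\<exists>h. is_function_via X h A B \<and> inj_on h (B ` space X))"

definition relabelling_rel ::
  "'x measure \<Rightarrow> 't set \<Rightarrow> ('t \<Rightarrow> 'x measure) \<Rightarrow> (('x \<Rightarrow> nat) \<times> ('x \<Rightarrow> nat)) set" where
  "relabelling_rel X \<Theta> P =
     {(A, B). ancillary X \<Theta> P A \<and> ancillary X \<Theta> P B \<and> relabelling X A B}"

definition countably_many_ancillaries ::
  "'x measure \<Rightarrow> 't set \<Rightarrow> ('t \<Rightarrow> 'x measure) \<Rightarrow> bool" where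
  "countably_many_ancillaries X \<Theta> P \<longleftrightarrow>
     countable ({A. ancillary X \<Theta> P A} // relabelling_rel X \<Theta> P)"

text \<open>Combining the statistics \<open>A 0, A 1, \<dots>\<close> gives a statistic with values in \<open>nat \<Rightarrow> nat\<close>,
  with the product sigma-algebra. It need not be ancillary; if it is, it is required to be
  discrete again. Finitely many statistics are covered by repetition.\<close>

definition discrete_combinations ::
  "'x measure \<Rightarrow> 't set \<Rightarrow> ('t \<Rightarrow> 'x measure) \<Rightarrow> bool" where
  "discrete_combinations X \<Theta> P \<longleftrightarrow>
     (\<forall>A :: nat \<Rightarrow> 'x \<Rightarrow> nat.
        (\<forall>n. ancillary X \<Theta> P (A n)) \<and>
        ancillary_into X \<Theta> P (PiM UNIV (\<lambda>_. count_space UNIV)) (\<lambda>x n. A n x) \<longrightarrow>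
        (\<exists>B :: 'x \<Rightarrow> nat. ancillary X \<Theta> P B \<and> relabelling X B (\<lambda>x n. A n x)))"

definition maximal_ancillary ::
  "'x measure \<Rightarrow> 't set \<Rightarrow> ('t \<Rightarrow> 'x measure) \<Rightarrow> ('x \<Rightarrow> nat) \<Rightarrow> bool" where
  "maximal_ancillary X \<Theta> P A \<longleftrightarrow>
     ancillary X \<Theta> P A \<and>
     (\<forall>A' h. ancillary X \<Theta> P A' \<and> is_function_via X h A A' \<longrightarrow> inj_on h (A' ` space X))"

definition minimal_ancillary ::
  "'x measure \<Rightarrow> 't set \<Rightarrow> ('t \<Rightarrow> 'x measure) \<Rightarrow> ('x \<Rightarrow> nat) \<Rightarrow> bool" where
  "minimal_ancillary X \<Theta> P A \<longleftrightarrow>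
     ancillary X \<Theta> P A \<and>
     (\<forall>A'. maximal_ancillary X \<Theta> P A' \<longrightarrow> (\<exists>h. is_function_via X h A A'))"

definition maximal_minimal_ancillary ::
  "'x measure \<Rightarrow> 't set \<Rightarrow> ('t \<Rightarrow> 'x measure) \<Rightarrow> ('x \<Rightarrow> nat) \<Rightarrow> bool" where
  "maximal_minimal_ancillary X \<Theta> P A \<longleftrightarrow>
     minimal_ancillary X \<Theta> P A \<and>
     (\<forall>A' h. minimal_ancillary X \<Theta> P A' \<and> is_function_via X h A A' \<longrightarrow>
        inj_on h (A' ` space X))"

text \<open>The choice of the parameter below is immaterial when \<open>V\<close> is ancillary.\<close>

definition possible_values ::
  "'x measure \<Rightarrow> 't set \<Rightarrow> ('t \<Rightarrow> 'x measure) \<Rightarrow> ('x \<Rightarrow> nat) \<Rightarrow> nat set" where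
  "possible_values X \<Theta> P V =
     {i. \<exists>\<theta>\<in>\<Theta>. measure (distr (P \<theta>) (count_space UNIV) V) {i} > 0}"

definition conditional_model ::
  "'x measure \<Rightarrow> ('t \<Rightarrow> 'x measure) \<Rightarrow> ('x \<Rightarrow> nat) \<Rightarrow> nat \<Rightarrow> 't \<Rightarrow> 'x measure" where
  "conditional_model X P V i \<theta> = uniform_measure (P \<theta>) {x \<in> space X. V x = i}"

text \<open>The mixture is formed in the Giry monad; \<open>emeasure_mixture_model\<close> below shows that it is
  the countable convex combination of the conditional distributions.\<close>

definition mixture_model ::
  "'x measure \<Rightarrow> ('t \<Rightarrow> 'x measure) \<Rightarrow> ('x \<Rightarrow> nat) \<Rightarrow> nat pmf \<Rightarrow> 't \<Rightarrow> 'x measure" where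
  "mixture_model X P V p \<theta> = measure_pmf p \<bind> (\<lambda>i. conditional_model X P V i \<theta>)"

definition stable_ancillary ::
  "'x measure \<Rightarrow> 't set \<Rightarrow> ('t \<Rightarrow> 'x measure) \<Rightarrow> ('x \<Rightarrow> nat) \<Rightarrow> bool" where
  "stable_ancillary X \<Theta> P U \<longleftrightarrow>
     ancillary X \<Theta> P U \<and>
     (\<forall>V. ancillary X \<Theta> P V \<longrightarrow>
        (\<forall>p. set_pmf p \<subseteq> possible_values X \<Theta> P V \<longrightarrow>
           ancillary X \<Theta> (mixture_model X P V p) U))"

definition strong_ancillary ::
  "'x measure \<Rightarrow> 't set \<Rightarrow> ('t \<Rightarrow> 'x measure) \<Rightarrow> ('x \<Rightarrow> nat) \<Rightarrow> bool" where
  "strong_ancillary X \<Theta> P U \<longleftrightarrow>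
     ancillary X \<Theta> P U \<and>
     (\<forall>V. ancillary X \<Theta> P V \<longrightarrow>
        (\<forall>p. set_pmf p \<subseteq> possible_values X \<Theta> P U \<longrightarrow>
           ancillary X \<Theta> (mixture_model X P U p) V))"

lemma conditional_model_subprob:
  assumes "prob_space (P \<theta>)" "sets (P \<theta>) = sets X" "V \<in> measurable X (count_space UNIV)"
  shows "conditional_model X P V i \<theta> \<in> space (subprob_algebra X)"
proof -
  interpret prob_space "P \<theta>" by fact
  let ?S = "{x \<in> space X. V x = i}"
  have S: "?S \<in> sets (P \<theta>)" using assms by simp
  have sp: "space (P \<theta>) = space X" using assms(2) by (rule sets_eq_imp_space_eq)
  have "emeasure (uniform_measure (P \<theta>) ?S) (space (P \<theta>)) \<le> 1"
  proof (cases "emeasure (P \<theta>) ?S = 0")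
    case True
    have "emeasure (P \<theta>) (?S \<inter> space (P \<theta>)) = 0"
      using True S by (simp add: sp Int_absorb2)
    then show ?thesis using S by (simp add: True)
  next
    case False
    then have "emeasure (uniform_measure (P \<theta>) ?S) (space (P \<theta>)) = 1"
      using prob_space.emeasure_space_1[OF prob_space_uniform_measure[of "P \<theta>" ?S]]
        emeasure_finite[of ?S] by simp
    then show ?thesis by simp
  qed
  moreover have "space X \<noteq> {}" using not_empty sp by simp
  ultimately show ?thesis
    by (auto simp: space_subprob_algebra conditional_model_def assms(2) sp intro!: subprob_spaceI)
qed

lemma emeasure_mixture_model:
  assumes "prob_space (P \<theta>)" "sets (P \<theta>) = sets X" "V \<in> measurable X (count_space UNIV)"
    and "B \<in> sets X"
  shows "emeasure (mixture_model X P V p \<theta>) B =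
    (\<Sum>i. ennreal (pmf p i) * (emeasure (P \<theta>) ({x \<in> space X. V x = i} \<inter> B) /
       emeasure (P \<theta>) {x \<in> space X. V x = i}))"
proof -
  have "(\<lambda>i. conditional_model X P V i \<theta>) \<in> measurable (measure_pmf p) (subprob_algebra X)"
    using conditional_model_subprob[where P = P and \<theta> = \<theta>, OF assms(1-3)] by simp
  then have "emeasure (mixture_model X P V p \<theta>) B =
      (\<integral>\<^sup>+ i. emeasure (conditional_model X P V i \<theta>) B \<partial>measure_pmf p)"
    using assms(4) unfolding mixture_model_def by (intro emeasure_bind) auto
  also have "\<dots> = (\<Sum>i. ennreal (pmf p i) * emeasure (conditional_model X P V i \<theta>) B)"
    by (simp add: nn_integral_measure_pmf nn_integral_count_space_nat)
  also have "\<dots> = (\<Sum>i. ennreal (pmf p i) * (emeasure (P \<theta>) ({x \<in> space X. V x = i} \<inter> B) /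
       emeasure (P \<theta>) {x \<in> space X. V x = i}))"
    using assms by (simp add: conditional_model_def)
  finally show ?thesis .
qed

lemma sets_mixture_model:
  assumes "prob_space (P \<theta>)" "sets (P \<theta>) = sets X" "V \<in> measurable X (count_space UNIV)"
  shows "sets (mixture_model X P V p \<theta>) = sets X"
  unfolding mixture_model_def
  by (rule sets_bind) (use conditional_model_subprob[where P = P and \<theta> = \<theta>, OF assms] in \<open>auto simp: space_subprob_algebra\<close>)

end

theory Submission
  imports Defs
begin

text \<open>A statistic matters here only through the pairs of points that it tells apart: \<open>A\<close> is a
  function of \<open>B\<close> exactly when \<open>B\<close> separates every pair that \<open>A\<close> separates, and the two are
  relabellings of each other exactly when they separate the same pairs. Ancillaries up to
  relabelling thus become a family of sets ordered by inclusion, and the whole proof takes place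
  in this order.

  Both the stable and the strong ancillaries \<open>U\<close> are those whose pair \<open>(U, V)\<close> with any ancillary
  \<open>V\<close> is again ancillary. Indeed, degenerate mixtures already show that the conditional law of
  one component given the other is free of the parameter, hence so is the joint law; conversely,
  the law of \<open>U\<close> under a mixture is computed from the joint law
  (\<open>stable_ancillary_iff_pairs\<close>, \<open>strong_ancillary_iff_pairs\<close>).

  The hypotheses on the model provide suprema: an upward directed nonempty family of ancillaries
  has, by countability, a sequence of representatives, and directedness makes all finite
  dimensional marginals of the combined statistic free of the parameter, so the combination is
  ancillary and hence discrete (\<open>directed_ancillaries_have_supremum\<close>). Chains are directed, so
  Zorn's lemma places a maximal ancillary above every ancillary
  (\<open>maximal_ancillary_above\<close>).

  Part (i) follows. If \<open>U\<close> is minimal and \<open>V\<close> is ancillary, both are functions of a maximal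
  ancillary above \<open>V\<close>, and so is their pair, which is therefore ancillary. If all pairs with \<open>U\<close>
  are ancillary, then the pair of \<open>U\<close> with a maximal ancillary \<open>A\<close> cannot be strictly finer than \<open>A\<close>, so
  \<open>U\<close> is a function of \<open>A\<close>. For part (ii), the pair description of minimality shows that the
  minimal ancillaries are closed under pairing, hence directed; their supremum is the
  laminal ancillary.\<close>

section \<open>Statistics as sets of separated pairs\<close>

definition separated_pairs :: "'x measure \<Rightarrow> ('x \<Rightarrow> 'a) \<Rightarrow> ('x \<times> 'x) set" where
  "separated_pairs X A = {(x, y). x \<in> space X \<and> y \<in> space X \<and> A x \<noteq> A y}"

text \<open>A function \<open>h\<close> with \<open>A = h(B)\<close> can be read off by choosing, for each value of \<open>B\<close>, any
  sample point at which it is attained.\<close>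

lemma is_function_iff_separated_pairs_subset:
  "(\<exists>h. is_function_via X h A B) \<longleftrightarrow> separated_pairs X A \<subseteq> separated_pairs X B"
proof
  assume "\<exists>h. is_function_via X h A B"
  then show "separated_pairs X A \<subseteq> separated_pairs X B"
    unfolding is_function_via_def separated_pairs_def by fastforce
next
  assume sub: "separated_pairs X A \<subseteq> separated_pairs X B"
  let ?pick = "\<lambda>b. SOME y. y \<in> space X \<and> B y = b"
  have "A x = A (?pick (B x))" if x: "x \<in> space X" for x
  proof -
    have "?pick (B x) \<in> space X \<and> B (?pick (B x)) = B x"
      using x by (intro someI[of "\<lambda>y. y \<in> space X \<and> B y = B x" x]) simp
    then show ?thesis
      using sub x unfolding separated_pairs_def by fastforce
  qed
  then have "is_function_via X (\<lambda>b. A (?pick b)) A B"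
    unfolding is_function_via_def by simp
  then show "\<exists>h. is_function_via X h A B" by blast
qed

lemma inj_on_iff_separated_pairs_subset:
  assumes "is_function_via X h A B"
  shows "inj_on h (B ` space X) \<longleftrightarrow> separated_pairs X B \<subseteq> separated_pairs X A"
proof -
  have A: "A x = h (B x)" if "x \<in> space X" for x
    using assms that by (simp add: is_function_via_def)
  have "inj_on h (B ` space X) \<longleftrightarrow> (\<forall>x\<in>space X. \<forall>y\<in>space X. B x \<noteq> B y \<longrightarrow> A x \<noteq> A y)"
    unfolding inj_on_def by (auto simp: A)
  also have "\<dots> \<longleftrightarrow> separated_pairs X B \<subseteq> separated_pairs X A"
    unfolding separated_pairs_def by blast
  finally show ?thesis .
qed

lemma relabelling_iff_separated_pairs_eq:
  "relabelling X A B \<longleftrightarrow> separated_pairs X A = separated_pairs X B"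
  unfolding relabelling_def
  using is_function_iff_separated_pairs_subset[of X A B] inj_on_iff_separated_pairs_subset[of X _ A B]
  by blast

text \<open>Maximality among all ancillaries and maximality among the minimal ones impose this same
  condition on the competitors \<open>B\<close> of \<open>A\<close>.\<close>

lemma functions_inj_on_iff:
  "(\<forall>h. is_function_via X h A B \<longrightarrow> inj_on h (B ` space X)) \<longleftrightarrow>
    (separated_pairs X A \<subseteq> separated_pairs X B \<longrightarrow> separated_pairs X B \<subseteq> separated_pairs X A)"
  using is_function_iff_separated_pairs_subset[of X A B] inj_on_iff_separated_pairs_subset[of X _ A B]
  by blast

lemma maximal_ancillary_iff:
  "maximal_ancillary X \<Theta> P A \<longleftrightarrow> ancillary X \<Theta> P A \<and>
     (\<forall>B. ancillary X \<Theta> P B \<and> separated_pairs X A \<subseteq> separated_pairs X B \<longrightarrow>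
        separated_pairs X B \<subseteq> separated_pairs X A)"
  unfolding maximal_ancillary_def using functions_inj_on_iff[of X A] by blast

lemma minimal_ancillary_iff:
  "minimal_ancillary X \<Theta> P A \<longleftrightarrow> ancillary X \<Theta> P A \<and>
     (\<forall>B. maximal_ancillary X \<Theta> P B \<longrightarrow> separated_pairs X A \<subseteq> separated_pairs X B)"
  unfolding minimal_ancillary_def is_function_iff_separated_pairs_subset ..

lemma maximal_minimal_ancillary_iff:
  "maximal_minimal_ancillary X \<Theta> P A \<longleftrightarrow> minimal_ancillary X \<Theta> P A \<and>
     (\<forall>B. minimal_ancillary X \<Theta> P B \<and> separated_pairs X A \<subseteq> separated_pairs X B \<longrightarrow>
        separated_pairs X B \<subseteq> separated_pairs X A)"
  unfolding maximal_minimal_ancillary_def using functions_inj_on_iff[of X A] by blast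

text \<open>Natural-number coding turns a pair of discrete statistics into a discrete statistic; it is
  the least upper bound of the two in the order of separated pairs.\<close>

definition pair_statistic :: "('x \<Rightarrow> nat) \<Rightarrow> ('x \<Rightarrow> nat) \<Rightarrow> 'x \<Rightarrow> nat" where
  "pair_statistic U V x = prod_encode (U x, V x)"

lemma separated_pairs_pair_statistic [simp]:
  "separated_pairs X (pair_statistic U V) = separated_pairs X U \<union> separated_pairs X V"
  by (auto simp: separated_pairs_def pair_statistic_def)

lemma separated_pairs_combination:
  "separated_pairs X (\<lambda>x n. A n x) = (\<Union>n. separated_pairs X (A n))"
  by (auto simp: separated_pairs_def fun_eq_iff)

section \<open>Parameter-free laws\<close>

lemma ancillary_intoI:
  assumes "A \<in> measurable X C"
    and "\<And>\<theta> \<theta>'. \<theta> \<in> \<Theta> \<Longrightarrow> \<theta>' \<in> \<Theta> \<Longrightarrow> distr (P \<theta>) C A = distr (P \<theta>') C A"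
  shows "ancillary_into X \<Theta> P C A"
proof (cases "\<Theta> = {}")
  case False
  then obtain \<eta> where "\<eta> \<in> \<Theta>" by blast
  then have "\<forall>\<theta>\<in>\<Theta>. distr (P \<theta>) C A = distr (P \<eta>) C A"
    using assms(2) by blast
  with assms(1) show ?thesis unfolding ancillary_into_def by blast
qed (use assms(1) in \<open>simp add: ancillary_into_def\<close>)

lemma ancillary_measurable:
  "ancillary X \<Theta> P A \<Longrightarrow> A \<in> measurable X (count_space UNIV)"
  by (simp add: ancillary_into_def)

lemma emeasure_distr_discrete:
  assumes "sets M = sets X" and "A \<in> measurable X (count_space UNIV)"
  shows "emeasure (distr M (count_space UNIV) A) S = emeasure M {x\<in>space X. A x \<in> S}"
proof -
  have "A \<in> measurable M (count_space UNIV)"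
    using assms measurable_cong_sets[OF assms(1) refl] by blast
  moreover have "A -` S \<inter> space M = {x\<in>space X. A x \<in> S}"
    using sets_eq_imp_space_eq[OF assms(1)] by auto
  ultimately show ?thesis by (simp add: emeasure_distr)
qed

lemma ancillary_event_free:
  assumes sets: "\<forall>\<theta>\<in>\<Theta>. sets (P \<theta>) = sets X"
    and A: "ancillary X \<Theta> P A" and \<theta>: "\<theta> \<in> \<Theta>" "\<theta>' \<in> \<Theta>"
  shows "emeasure (P \<theta>) {x\<in>space X. A x \<in> S} = emeasure (P \<theta>') {x\<in>space X. A x \<in> S}"
proof -
  have "distr (P \<theta>) (count_space UNIV) A = distr (P \<theta>') (count_space UNIV) A"
    using A \<theta> unfolding ancillary_into_def by auto
  then show ?thesis
    using emeasure_distr_discrete[OF bspec[OF sets \<theta>(1)] ancillary_measurable[OF A], of S]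
      emeasure_distr_discrete[OF bspec[OF sets \<theta>(2)] ancillary_measurable[OF A], of S] by simp
qed

text \<open>A law on \<open>nat\<close> is determined by its point masses. The criterion asks only for the right
  sigma-algebra, so that it applies to the model and to its mixtures alike.\<close>

lemma ancillary_iff_emeasure:
  assumes sets: "\<forall>\<theta>\<in>\<Theta>. sets (P \<theta>) = sets X"
  shows "ancillary X \<Theta> P A \<longleftrightarrow> A \<in> measurable X (count_space UNIV) \<and>
    (\<forall>\<theta>\<in>\<Theta>. \<forall>\<theta>'\<in>\<Theta>. \<forall>i.
       emeasure (P \<theta>) {x\<in>space X. A x = i} = emeasure (P \<theta>') {x\<in>space X. A x = i})"
    (is "_ \<longleftrightarrow> ?meas \<and> ?free")
proof
  assume anc: "ancillary X \<Theta> P A"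
  have "emeasure (P \<theta>) {x\<in>space X. A x = i} = emeasure (P \<theta>') {x\<in>space X. A x = i}"
    if "\<theta> \<in> \<Theta>" "\<theta>' \<in> \<Theta>" for \<theta> \<theta>' i
    using ancillary_event_free[OF sets anc that, of "{i}"] by simp
  with ancillary_measurable[OF anc] show "?meas \<and> ?free" by blast
next
  assume *: "?meas \<and> ?free"
  have "distr (P \<theta>) (count_space UNIV) A = distr (P \<theta>') (count_space UNIV) A"
    if "\<theta> \<in> \<Theta>" "\<theta>' \<in> \<Theta>" for \<theta> \<theta>'
  proof (rule measure_eqI_countable[where A=UNIV])
    show "emeasure (distr (P \<theta>) (count_space UNIV) A) {i} =
        emeasure (distr (P \<theta>') (count_space UNIV) A) {i}" for i
    proof -
      have "emeasure (P \<theta>) {x\<in>space X. A x = i} = emeasure (P \<theta>') {x\<in>space X. A x = i}"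
        using * that by blast
      then show ?thesis
        using emeasure_distr_discrete[OF bspec[OF sets that(1)], of A "{i}"]
          emeasure_distr_discrete[OF bspec[OF sets that(2)], of A "{i}"] * by simp
    qed
  qed simp_all
  with * show "ancillary X \<Theta> P A" by (intro ancillary_intoI) blast+
qed

lemma ancillary_of_finer:
  fixes A B :: "'x \<Rightarrow> nat"
  assumes sets: "\<forall>\<theta>\<in>\<Theta>. sets (P \<theta>) = sets X"
    and B: "ancillary X \<Theta> P B" and sub: "separated_pairs X A \<subseteq> separated_pairs X B"
  shows "ancillary X \<Theta> P A"
proof -
  obtain h where h: "\<And>x. x \<in> space X \<Longrightarrow> A x = h (B x)"
    using sub is_function_iff_separated_pairs_subset[of X A B] unfolding is_function_via_def by blast
  have "(\<lambda>x. h (B x)) \<in> measurable X (count_space UNIV)"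
    using measurable_compose[OF ancillary_measurable[OF B], of h] by simp
  then have "A \<in> measurable X (count_space UNIV)"
    using measurable_cong[of X A "\<lambda>x. h (B x)"] h by blast
  moreover have "emeasure (P \<theta>) {x\<in>space X. A x = i} = emeasure (P \<theta>') {x\<in>space X. A x = i}"
    if "\<theta> \<in> \<Theta>" "\<theta>' \<in> \<Theta>" for \<theta> \<theta>' i
  proof -
    have "{x\<in>space X. A x = i} = {x\<in>space X. B x \<in> h -` {i}}"
      using h by auto
    then show ?thesis
      using ancillary_event_free[OF sets B that] by (simp only:)
  qed
  ultimately show ?thesis
    using ancillary_iff_emeasure[OF sets, of A] by blast
qed

lemma ancillary_const:
  assumes "statistical_model X \<Theta> P"
  shows "ancillary X \<Theta> P (\<lambda>_. c)"
proof -
  have sets: "\<forall>\<theta>\<in>\<Theta>. sets (P \<theta>) = sets X"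
    using assms by (simp add: statistical_model_def)
  have "emeasure (P \<theta>) {x\<in>space X. c = i} = (if c = i then 1 else 0)" if "\<theta> \<in> \<Theta>" for \<theta> i
  proof -
    have "prob_space (P \<theta>)"
      using assms that by (simp add: statistical_model_def)
    then show ?thesis
      using prob_space.emeasure_space_1[of "P \<theta>"] sets_eq_imp_space_eq[OF bspec[OF sets that]] by simp
  qed
  then show ?thesis by (simp add: ancillary_iff_emeasure[OF sets])
qed

section \<open>Stability and strength as ancillarity of pairs\<close>

lemma ancillary_pair_iff:
  assumes P: "statistical_model X \<Theta> P"
    and U: "U \<in> measurable X (count_space UNIV)" and V: "V \<in> measurable X (count_space UNIV)"
  shows "ancillary X \<Theta> P (pair_statistic U V) \<longleftrightarrow>
    (\<forall>\<theta>\<in>\<Theta>. \<forall>\<theta>'\<in>\<Theta>. \<forall>i j. emeasure (P \<theta>) ({x\<in>space X. V x = i} \<inter> {x\<in>space X. U x = j}) =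
       emeasure (P \<theta>') ({x\<in>space X. V x = i} \<inter> {x\<in>space X. U x = j}))"
proof -
  have sets: "\<forall>\<theta>\<in>\<Theta>. sets (P \<theta>) = sets X"
    using P by (simp add: statistical_model_def)
  have "pair_statistic U V \<in> measurable X (count_space UNIV)"
    unfolding pair_statistic_def using U V by measurable
  moreover have "{x\<in>space X. pair_statistic U V x = prod_encode (j, i)} =
      {x\<in>space X. V x = i} \<inter> {x\<in>space X. U x = j}" for i j
    by (auto simp: pair_statistic_def)
  moreover have "(\<forall>k. Q k) \<longleftrightarrow> (\<forall>i j. Q (prod_encode (j, i)))" for Q
    by (metis prod_decode_inverse surj_pair)
  note codes = this[of "\<lambda>k. emeasure (P \<theta>) {x\<in>space X. pair_statistic U V x = k} =
    emeasure (P \<theta>') {x\<in>space X. pair_statistic U V x = k}" for \<theta> \<theta>']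
  ultimately show ?thesis
    unfolding ancillary_iff_emeasure[OF sets] codes by simp
qed

lemma emeasure_degenerate_mixture:
  assumes "prob_space (P \<theta>)" "sets (P \<theta>) = sets X" "V \<in> measurable X (count_space UNIV)"
    and "B \<in> sets X"
  shows "emeasure (mixture_model X P V (return_pmf i) \<theta>) B =
    emeasure (P \<theta>) ({x\<in>space X. V x = i} \<inter> B) / emeasure (P \<theta>) {x\<in>space X. V x = i}"
    (is "_ = ?cond i")
proof -
  have "emeasure (mixture_model X P V (return_pmf i) \<theta>) B = (\<Sum>k. ennreal (pmf (return_pmf i) k) * ?cond k)"
    by (rule emeasure_mixture_model[where P=P and \<theta>=\<theta>, OF assms])
  also have "\<dots> = (\<Sum>k\<in>{i}. ennreal (pmf (return_pmf i) k) * ?cond k)"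
    by (rule suminf_finite) (auto simp: pmf_return)
  finally show ?thesis by simp
qed

text \<open>Conditioning on the single value \<open>i\<close> is the mixture with all its mass at \<open>i\<close>. Multiplying
  the conditional law of \<open>U\<close> by the probability of \<open>V = i\<close>, which is free of the parameter, gives
  the joint law; values \<open>i\<close> of probability zero contribute nothing to it.\<close>

lemma ancillary_pair_if_mixtures:
  assumes P: "statistical_model X \<Theta> P"
    and U: "U \<in> measurable X (count_space UNIV)" and V: "ancillary X \<Theta> P V"
    and mix: "\<And>p. set_pmf p \<subseteq> possible_values X \<Theta> P V \<Longrightarrow> ancillary X \<Theta> (mixture_model X P V p) U"
  shows "ancillary X \<Theta> P (pair_statistic U V)"
proof -
  have prob: "\<forall>\<theta>\<in>\<Theta>. prob_space (P \<theta>)" and sets: "\<forall>\<theta>\<in>\<Theta>. sets (P \<theta>) = sets X"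
    using P by (auto simp: statistical_model_def)
  have Vm: "V \<in> measurable X (count_space UNIV)"
    using V by (rule ancillary_measurable)
  have "emeasure (P \<theta>) ({x\<in>space X. V x = i} \<inter> {x\<in>space X. U x = j}) =
      emeasure (P \<theta>') ({x\<in>space X. V x = i} \<inter> {x\<in>space X. U x = j})"
    if \<theta>: "\<theta> \<in> \<Theta>" "\<theta>' \<in> \<Theta>" for \<theta> \<theta>' i j
  proof -
    let ?V = "{x\<in>space X. V x = i}" and ?U = "{x\<in>space X. U x = j}"
    have meas: "?V \<in> sets X" "?U \<in> sets X" using U Vm by auto
    have V_free: "emeasure (P \<theta>) ?V = emeasure (P \<theta>') ?V"
      using V \<theta> ancillary_iff_emeasure[OF sets, where ?A=V] by blast
    show ?thesis
    proof (cases "emeasure (P \<theta>) ?V = 0")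
      case True
      have "emeasure (P \<eta>) (?V \<inter> ?U) = 0" if "\<eta> \<in> \<Theta>" "emeasure (P \<eta>) ?V = 0" for \<eta>
        using emeasure_mono[of "?V \<inter> ?U" ?V "P \<eta>"] meas that bspec[OF sets that(1)] by simp
      from this[OF \<theta>(1) True] this[OF \<theta>(2)] show ?thesis using True V_free by simp
    next
      case False
      have fin: "emeasure (P \<eta>) B \<noteq> \<infinity>" if "\<eta> \<in> \<Theta>" for \<eta> B
        using bspec[OF prob that] by (simp add: finite_measure.emeasure_finite prob_space.finite_measure)
      have "measure (distr (P \<theta>) (count_space UNIV) V) {i} = measure (P \<theta>) ?V"
        unfolding measure_def by (simp add: emeasure_distr_discrete[OF bspec[OF sets \<theta>(1)] Vm])
      moreover have "measure (P \<theta>) ?V > 0"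
        using False fin[OF \<theta>(1), of ?V] unfolding measure_def
        by (simp add: enn2real_positive_iff less_top zero_less_iff_neq_zero)
      ultimately have "set_pmf (return_pmf i) \<subseteq> possible_values X \<Theta> P V"
        by (auto simp: possible_values_def intro!: bexI[OF _ \<theta>(1)])
      note anc = mix[OF this]
      have cond: "emeasure (mixture_model X P V (return_pmf i) \<eta>) ?U =
          emeasure (P \<eta>) (?V \<inter> ?U) / emeasure (P \<eta>) ?V" if "\<eta> \<in> \<Theta>" for \<eta>
        using emeasure_degenerate_mixture[where P=P and \<theta>=\<eta>, OF bspec[OF prob that] bspec[OF sets that] Vm meas(2)] .
      have "\<forall>\<eta>\<in>\<Theta>. sets (mixture_model X P V (return_pmf i) \<eta>) = sets X"
        using prob sets by (simp add: sets_mixture_model Vm)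
      note ancillary_iff_emeasure[OF this, of U]
      then have "emeasure (mixture_model X P V (return_pmf i) \<theta>) ?U =
          emeasure (mixture_model X P V (return_pmf i) \<theta>') ?U"
        using anc \<theta> by blast
      then have eq: "emeasure (P \<theta>) (?V \<inter> ?U) / emeasure (P \<theta>) ?V =
          emeasure (P \<theta>') (?V \<inter> ?U) / emeasure (P \<theta>) ?V"
        unfolding cond[OF \<theta>(1)] cond[OF \<theta>(2)] V_free .
      have "emeasure (P \<theta>) ?V < \<top>"
        using fin[OF \<theta>(1), of ?V] by (simp add: less_top)
      \<comment> \<open>Division cancels in the extended reals only for a nonzero and finite denominator.\<close>
      with False have cancel: "a / emeasure (P \<theta>) ?V * emeasure (P \<theta>) ?V = a" for a
        by (simp add: ennreal_divide_times mult_divide_eq_ennreal)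
      show ?thesis using arg_cong[OF eq, of "\<lambda>a. a * emeasure (P \<theta>) ?V"] unfolding cancel .
    qed
  qed
  then show ?thesis by (subst ancillary_pair_iff[OF P U Vm]) blast
qed

lemma ancillary_mixture_if_pair:
  assumes P: "statistical_model X \<Theta> P"
    and U: "U \<in> measurable X (count_space UNIV)" and V: "ancillary X \<Theta> P V"
    and pair: "ancillary X \<Theta> P (pair_statistic U V)"
  shows "ancillary X \<Theta> (mixture_model X P V p) U"
proof -
  have prob: "\<forall>\<theta>\<in>\<Theta>. prob_space (P \<theta>)" and sets: "\<forall>\<theta>\<in>\<Theta>. sets (P \<theta>) = sets X"
    using P by (auto simp: statistical_model_def)
  have Vm: "V \<in> measurable X (count_space UNIV)"
    using V by (rule ancillary_measurable)
  have "emeasure (mixture_model X P V p \<theta>) {x\<in>space X. U x = j} =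
      emeasure (mixture_model X P V p \<theta>') {x\<in>space X. U x = j}"
    if \<theta>: "\<theta> \<in> \<Theta>" "\<theta>' \<in> \<Theta>" for \<theta> \<theta>' j
  proof -
    let ?V = "\<lambda>i. {x\<in>space X. V x = i}" and ?U = "{x\<in>space X. U x = j}"
    have "?U \<in> sets X" using U by simp
    note mixture = emeasure_mixture_model[where P=P, OF bspec[OF prob] bspec[OF sets] Vm this]
    have "emeasure (P \<theta>) (?V i) = emeasure (P \<theta>') (?V i)" for i
      using V \<theta> ancillary_iff_emeasure[OF sets, where ?A=V] by blast
    moreover have "emeasure (P \<theta>) (?V i \<inter> ?U) = emeasure (P \<theta>') (?V i \<inter> ?U)" for i
      using pair \<theta> ancillary_pair_iff[OF P U Vm] by blast
    ultimately show ?thesis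
      unfolding mixture[OF \<theta>(1) \<theta>(1)] mixture[OF \<theta>(2) \<theta>(2)] by simp
  qed
  moreover have "\<forall>\<theta>\<in>\<Theta>. sets (mixture_model X P V p \<theta>) = sets X"
    using prob sets by (simp add: sets_mixture_model Vm)
  ultimately show ?thesis
    using U ancillary_iff_emeasure[of \<Theta> "mixture_model X P V p" X U] by blast
qed

lemma ancillary_pair_commute:
  assumes P: "statistical_model X \<Theta> P" and "ancillary X \<Theta> P (pair_statistic U V)"
  shows "ancillary X \<Theta> P (pair_statistic V U)"
  using assms
  by (intro ancillary_of_finer[where A="pair_statistic V U" and B="pair_statistic U V"])
     (auto simp: statistical_model_def)

lemma ancillary_mixtures_iff_pair:
  assumes "statistical_model X \<Theta> P" "ancillary X \<Theta> P U" "ancillary X \<Theta> P V"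
  shows "(\<forall>p. set_pmf p \<subseteq> possible_values X \<Theta> P V \<longrightarrow> ancillary X \<Theta> (mixture_model X P V p) U) \<longleftrightarrow>
    ancillary X \<Theta> P (pair_statistic U V)"
  using ancillary_pair_if_mixtures[OF assms(1) ancillary_measurable[OF assms(2)] assms(3)]
    ancillary_mixture_if_pair[OF assms(1) ancillary_measurable[OF assms(2)] assms(3)]
  by auto

lemma stable_ancillary_iff_pairs:
  assumes "statistical_model X \<Theta> P" "ancillary X \<Theta> P U"
  shows "stable_ancillary X \<Theta> P U \<longleftrightarrow> (\<forall>V. ancillary X \<Theta> P V \<longrightarrow> ancillary X \<Theta> P (pair_statistic U V))"
  unfolding stable_ancillary_def
  using assms(2) ancillary_mixtures_iff_pair[OF assms] by simp

lemma strong_ancillary_iff_pairs: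
  assumes "statistical_model X \<Theta> P" "ancillary X \<Theta> P U"
  shows "strong_ancillary X \<Theta> P U \<longleftrightarrow> (\<forall>V. ancillary X \<Theta> P V \<longrightarrow> ancillary X \<Theta> P (pair_statistic U V))"
proof -
  have "strong_ancillary X \<Theta> P U \<longleftrightarrow> (\<forall>V. ancillary X \<Theta> P V \<longrightarrow> ancillary X \<Theta> P (pair_statistic V U))"
    unfolding strong_ancillary_def
    using assms(2) ancillary_mixtures_iff_pair[OF assms(1) _ assms(2)] by simp
  then show ?thesis
    using ancillary_pair_commute[OF assms(1)] by blast
qed

section \<open>Suprema of directed families of ancillaries\<close>

text \<open>A probability measure on a countable product is determined by its finite dimensional
  marginals, and each of these is the law of a function of one ancillary.\<close>

lemma ancillary_combination:
  fixes A :: "nat \<Rightarrow> 'x \<Rightarrow> nat"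
  assumes P: "statistical_model X \<Theta> P"
    and A: "\<And>n. ancillary X \<Theta> P (A n)"
    and bound: "\<And>J. finite J \<Longrightarrow>
      \<exists>B :: 'x \<Rightarrow> nat. ancillary X \<Theta> P B \<and> (\<forall>n\<in>J. separated_pairs X (A n) \<subseteq> separated_pairs X B)"
  shows "ancillary_into X \<Theta> P (PiM UNIV (\<lambda>_. count_space UNIV)) (\<lambda>x n. A n x)"
proof -
  let ?N = "PiM UNIV (\<lambda>_ :: nat. count_space (UNIV :: nat set))" and ?A = "\<lambda>x n. A n x"
  have prob: "\<forall>\<theta>\<in>\<Theta>. prob_space (P \<theta>)" and sets: "\<forall>\<theta>\<in>\<Theta>. sets (P \<theta>) = sets X"
    using P by (auto simp: statistical_model_def)
  have meas: "?A \<in> measurable X ?N"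
    using A by (intro measurable_PiM_single') (auto simp: ancillary_into_def)
  have "distr (P \<theta>) ?N ?A = distr (P \<theta>') ?N ?A" if \<theta>: "\<theta> \<in> \<Theta>" "\<theta>' \<in> \<Theta>" for \<theta> \<theta>'
  proof (rule measure_eqI_PiM_infinite)
    fix F :: "nat \<Rightarrow> nat set" and J :: "nat set" assume J: "finite J"
    let ?C = "prod_emb UNIV (\<lambda>_. count_space UNIV) J (Pi\<^sub>E J F) :: (nat \<Rightarrow> nat) set"
    obtain B :: "'x \<Rightarrow> nat" where B: "ancillary X \<Theta> P B"
      and sub: "\<And>n. n \<in> J \<Longrightarrow> separated_pairs X (A n) \<subseteq> separated_pairs X B"
      using bound[OF J] by blast
    have "\<exists>h. \<forall>x\<in>space X. A n x = h (B x)" if "n \<in> J" for n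
      using sub[OF that] is_function_iff_separated_pairs_subset[of X "A n" B]
      unfolding is_function_via_def by blast
    then obtain h where h: "\<And>n x. n \<in> J \<Longrightarrow> x \<in> space X \<Longrightarrow> A n x = h n (B x)"
      by metis
    have cyl: "?A -` ?C \<inter> space X = {x\<in>space X. B x \<in> {b. \<forall>n\<in>J. h n b \<in> F n}}"
      using h by (auto simp: prod_emb_def PiE_iff space_PiM)
    have C: "?C \<in> sets ?N"
      using J by (intro sets_PiM_I) auto
    have "emeasure (distr (P \<eta>) ?N ?A) ?C = emeasure (P \<eta>) {x\<in>space X. B x \<in> {b. \<forall>n\<in>J. h n b \<in> F n}}"
      if "\<eta> \<in> \<Theta>" for \<eta>
    proof -
      have "?A \<in> measurable (P \<eta>) ?N"
        using meas measurable_cong_sets[OF bspec[OF sets that] refl] by blast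
      then show ?thesis
        using C cyl sets_eq_imp_space_eq[OF bspec[OF sets that]] by (simp add: emeasure_distr)
    qed
    then show "emeasure (distr (P \<theta>) ?N ?A) ?C = emeasure (distr (P \<theta>') ?N ?A) ?C"
      using \<theta> ancillary_event_free[OF sets B \<theta>] by (simp only:)
  next
    have "?A \<in> measurable (P \<theta>) ?N"
      using meas measurable_cong_sets[OF bspec[OF sets \<theta>(1)] refl] by blast
    then show "finite_measure (distr (P \<theta>) ?N ?A)"
      using bspec[OF prob \<theta>(1)] by (intro prob_space.finite_measure prob_space.prob_space_distr)
  qed simp_all
  with meas show ?thesis by (rule ancillary_intoI)
qed

text \<open>Relabellings separate the same pairs, so one representative in \<open>T\<close> of each relabelling class
  that meets \<open>T\<close> suffices to exhaust the pairs separated by members of \<open>T\<close>.\<close>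

lemma enumeration_of_ancillaries:
  assumes count: "countably_many_ancillaries X \<Theta> P"
    and T: "\<And>A. A \<in> T \<Longrightarrow> ancillary X \<Theta> P A" "T \<noteq> {}"
  obtains a :: "nat \<Rightarrow> 'x \<Rightarrow> nat" where "range a \<subseteq> T"
    and "(\<Union>n. separated_pairs X (a n)) = (\<Union>A\<in>T. separated_pairs X A)"
proof -
  let ?class = "\<lambda>A. relabelling_rel X \<Theta> P `` {A}"
  define a where "a n = inv_into T ?class (from_nat_into (?class ` T) n)" for n
  have "?class ` T \<subseteq> {A. ancillary X \<Theta> P A} // relabelling_rel X \<Theta> P"
    using T(1) by (auto intro: quotientI)
  then have countable: "countable (?class ` T)"
    using count unfolding countably_many_ancillaries_def by (rule countable_subset)
  have "a n \<in> T" for n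
    unfolding a_def using T(2) by (intro inv_into_into from_nat_into) simp
  then have sub: "range a \<subseteq> T" by blast
  have "\<exists>n. separated_pairs X (a n) = separated_pairs X A" if A: "A \<in> T" for A
  proof -
    obtain n where n: "from_nat_into (?class ` T) n = ?class A"
      using from_nat_into_surj[OF countable imageI[OF A]] by blast
    have "a n \<in> T"
      using sub by blast
    moreover have "?class (a n) = ?class A"
      unfolding a_def n by (rule f_inv_into_f[where f="?class"]) (rule imageI[OF A])
    moreover have "a n \<in> ?class (a n)"
      using T(1) \<open>a n \<in> T\<close> by (simp add: relabelling_rel_def relabelling_iff_separated_pairs_eq)
    ultimately have "a n \<in> ?class A" by simp
    then have "separated_pairs X (a n) = separated_pairs X A"
      by (simp add: relabelling_rel_def relabelling_iff_separated_pairs_eq)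
    then show ?thesis ..
  qed
  then have "(\<Union>A\<in>T. separated_pairs X A) \<subseteq> (\<Union>n. separated_pairs X (a n))"
    by blast
  with sub show thesis by (intro that) blast+
qed

text \<open>Directedness bounds every finite part of an enumeration of \<open>T\<close> by a single ancillary, as
  needed for combining the whole enumeration into one ancillary.\<close>

lemma directed_ancillaries_have_supremum:
  fixes T :: "('x \<Rightarrow> nat) set"
  assumes P: "statistical_model X \<Theta> P"
    and discrete: "discrete_combinations X \<Theta> P"
    and count: "countably_many_ancillaries X \<Theta> P"
    and T: "\<And>A. A \<in> T \<Longrightarrow> ancillary X \<Theta> P A" "T \<noteq> {}"
    and directed: "\<And>A B. A \<in> T \<Longrightarrow> B \<in> T \<Longrightarrow>
      \<exists>C\<in>T. separated_pairs X A \<union> separated_pairs X B \<subseteq> separated_pairs X C"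
  obtains L :: "'x \<Rightarrow> nat" where "ancillary X \<Theta> P L"
    and "separated_pairs X L = (\<Union>A\<in>T. separated_pairs X A)"
proof -
  obtain a :: "nat \<Rightarrow> 'x \<Rightarrow> nat" where a: "range a \<subseteq> T"
    "(\<Union>n. separated_pairs X (a n)) = (\<Union>A\<in>T. separated_pairs X A)"
    using enumeration_of_ancillaries[OF count T] by blast
  have "\<exists>B\<in>T. \<forall>n\<in>J. separated_pairs X (a n) \<subseteq> separated_pairs X B" if "finite J" for J
    using that
  proof (induction J)
    case empty
    then show ?case using T(2) by blast
  next
    case (insert k J)
    then obtain B where B: "B \<in> T" "\<forall>n\<in>J. separated_pairs X (a n) \<subseteq> separated_pairs X B" by blast
    obtain C where "C \<in> T" "separated_pairs X (a k) \<union> separated_pairs X B \<subseteq> separated_pairs X C"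
      using directed[of "a k" B] a(1) B(1) by blast
    with B show ?case by (intro bexI[of _ C]) auto
  qed
  then have "ancillary_into X \<Theta> P (PiM UNIV (\<lambda>_. count_space UNIV)) (\<lambda>x n. a n x)"
    using T(1) a(1) by (intro ancillary_combination[OF P]) blast+
  then obtain L where "ancillary X \<Theta> P L" "relabelling X L (\<lambda>x n. a n x)"
    using discrete T(1) a(1) unfolding discrete_combinations_def by blast
  with a(2) show thesis
    using that by (simp add: relabelling_iff_separated_pairs_eq separated_pairs_combination)
qed

text \<open>The separated sets of the ancillaries above \<open>V\<close> are closed under unions of nonempty chains,
  which is what Zorn's lemma for set inclusion asks for.\<close>

lemma maximal_ancillary_above:
  assumes P: "statistical_model X \<Theta> P"
    and discrete: "discrete_combinations X \<Theta> P"
    and count: "countably_many_ancillaries X \<Theta> P"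
    and V: "ancillary X \<Theta> P V"
  obtains A where "maximal_ancillary X \<Theta> P A" "separated_pairs X V \<subseteq> separated_pairs X A"
proof -
  let ?above = "{A. ancillary X \<Theta> P A \<and> separated_pairs X V \<subseteq> separated_pairs X A}"
  let ?\<S> = "separated_pairs X ` ?above"
  have "\<exists>M\<in>?\<S>. \<forall>S\<in>?\<S>. M \<subseteq> S \<longrightarrow> S = M"
  proof (rule subset_Zorn_nonempty)
    show "?\<S> \<noteq> {}" using V by blast
  next
    fix \<C> assume ne: "\<C> \<noteq> {}" and chain: "subset.chain ?\<S> \<C>"
    let ?T = "{A \<in> ?above. separated_pairs X A \<in> \<C>}"
    have \<C>: "\<C> = separated_pairs X ` ?T"
      using chain unfolding subset.chain_def by auto
    have directed: "\<exists>C\<in>?T. separated_pairs X A \<union> separated_pairs X B \<subseteq> separated_pairs X C"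
      if AB: "A \<in> ?T" "B \<in> ?T" for A B
    proof -
      have "separated_pairs X A \<subseteq> separated_pairs X B \<or> separated_pairs X B \<subseteq> separated_pairs X A"
        using AB chain unfolding subset_chain_def by blast
      then show ?thesis using AB by blast
    qed
    have "?T \<noteq> {}" using ne \<C> by blast
    obtain L where L: "ancillary X \<Theta> P L" "separated_pairs X L = (\<Union>A\<in>?T. separated_pairs X A)"
      by (rule directed_ancillaries_have_supremum
          [OF P discrete count, where T="?T", OF _ \<open>?T \<noteq> {}\<close> directed]) simp
    from L(2) \<open>?T \<noteq> {}\<close> have "separated_pairs X V \<subseteq> separated_pairs X L" by blast
    with L(1) have "separated_pairs X L \<in> ?\<S>" by blast
    moreover have "separated_pairs X L = \<Union>\<C>"
      unfolding L(2) by (rule arg_cong[OF \<C>[symmetric]])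
    ultimately show "\<Union>\<C> \<in> ?\<S>" by (simp only:)
  qed
  then obtain M where M: "M \<in> ?\<S>" and maximal: "\<forall>S\<in>?\<S>. M \<subseteq> S \<longrightarrow> S = M"
    by (rule bexE)
  from M obtain A where A: "A \<in> ?above" and M_eq: "M = separated_pairs X A"
    by (rule imageE)
  have "separated_pairs X B \<subseteq> separated_pairs X A"
    if B: "ancillary X \<Theta> P B" "separated_pairs X A \<subseteq> separated_pairs X B" for B
  proof -
    have "B \<in> ?above" using A B by auto
    then show ?thesis
      using bspec[OF maximal imageI, of B] B(2) unfolding M_eq by simp
  qed
  with A have "maximal_ancillary X \<Theta> P A" unfolding maximal_ancillary_iff by blast
  with A show thesis using that by simp
qed

section \<open>Minimal ancillaries\<close>

text \<open>A minimal \<open>U\<close> and any \<open>V\<close> are functions of a common maximal ancillary, hence so is their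
  pair. Conversely, a maximal \<open>A\<close> is a function of the pair \<open>(U, A)\<close>; if that pair is ancillary,
  maximality forces it to be a relabelling of \<open>A\<close>.\<close>

lemma minimal_ancillary_iff_pairs:
  assumes P: "statistical_model X \<Theta> P"
    and discrete: "discrete_combinations X \<Theta> P"
    and count: "countably_many_ancillaries X \<Theta> P"
    and U: "ancillary X \<Theta> P U"
  shows "minimal_ancillary X \<Theta> P U \<longleftrightarrow> (\<forall>V. ancillary X \<Theta> P V \<longrightarrow> ancillary X \<Theta> P (pair_statistic U V))"
proof (intro iffI allI impI)
  fix V assume min: "minimal_ancillary X \<Theta> P U" and V: "ancillary X \<Theta> P V"
  obtain A where A: "maximal_ancillary X \<Theta> P A" and "separated_pairs X V \<subseteq> separated_pairs X A"
    using maximal_ancillary_above[OF P discrete count V] .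
  moreover have "separated_pairs X U \<subseteq> separated_pairs X A"
    using min A unfolding minimal_ancillary_iff by blast
  ultimately show "ancillary X \<Theta> P (pair_statistic U V)"
    using P by (intro ancillary_of_finer[where A="pair_statistic U V" and B=A])
      (auto simp: maximal_ancillary_iff statistical_model_def)
next
  assume pairs: "\<forall>V. ancillary X \<Theta> P V \<longrightarrow> ancillary X \<Theta> P (pair_statistic U V)"
  have "separated_pairs X U \<subseteq> separated_pairs X A" if "maximal_ancillary X \<Theta> P A" for A
  proof -
    have "ancillary X \<Theta> P A"
      using that by (simp add: maximal_ancillary_iff)
    with pairs have "ancillary X \<Theta> P (pair_statistic U A)" by blast
    moreover have "separated_pairs X A \<subseteq> separated_pairs X (pair_statistic U A)" by simp
    ultimately have "separated_pairs X (pair_statistic U A) \<subseteq> separated_pairs X A"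
      using that unfolding maximal_ancillary_iff by blast
    then show ?thesis by simp
  qed
  with U show "minimal_ancillary X \<Theta> P U" unfolding minimal_ancillary_iff by blast
qed

text \<open>The pair of two minimal ancillaries is ancillary by the pair criterion, and it is a function
  of every ancillary of which both components are functions.\<close>

lemma minimal_ancillary_pair:
  assumes "statistical_model X \<Theta> P" "discrete_combinations X \<Theta> P" "countably_many_ancillaries X \<Theta> P"
    and "minimal_ancillary X \<Theta> P U" "minimal_ancillary X \<Theta> P V"
  shows "minimal_ancillary X \<Theta> P (pair_statistic U V)"
proof -
  have "ancillary X \<Theta> P (pair_statistic U V)"
    using assms minimal_ancillary_iff_pairs[OF assms(1-3)] unfolding minimal_ancillary_def by blast
  then show ?thesis
    using assms(4,5) by (simp add: minimal_ancillary_iff)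
qed

lemma laminal_ancillary_exists:
  assumes P: "statistical_model X \<Theta> P"
    and discrete: "discrete_combinations X \<Theta> P"
    and count: "countably_many_ancillaries X \<Theta> P"
  shows "\<exists>L. maximal_minimal_ancillary X \<Theta> P L"
proof -
  let ?T = "{A. minimal_ancillary X \<Theta> P A}"
  have "minimal_ancillary X \<Theta> P (\<lambda>_. 0)"
    using ancillary_const[OF P] by (simp add: minimal_ancillary_iff separated_pairs_def)
  then have "?T \<noteq> {}" by blast
  have directed: "\<exists>C\<in>?T. separated_pairs X A \<union> separated_pairs X B \<subseteq> separated_pairs X C"
    if "A \<in> ?T" "B \<in> ?T" for A B
    using that minimal_ancillary_pair[OF P discrete count, of A B]
    by (intro bexI[of _ "pair_statistic A B"]) auto
  obtain L where L: "ancillary X \<Theta> P L" "separated_pairs X L = (\<Union>A\<in>?T. separated_pairs X A)"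
    by (rule directed_ancillaries_have_supremum
        [OF P discrete count, where T="?T", OF _ \<open>?T \<noteq> {}\<close> directed]) (simp add: minimal_ancillary_def)
  \<comment> \<open>A maximal ancillary separates whatever some minimal one separates, hence all that \<open>L\<close> does.\<close>
  have "separated_pairs X L \<subseteq> separated_pairs X B" if "maximal_ancillary X \<Theta> P B" for B
    unfolding L(2) using that by (intro UN_least) (simp add: minimal_ancillary_iff)
  with L(1) have "minimal_ancillary X \<Theta> P L"
    by (simp add: minimal_ancillary_iff)
  moreover have "separated_pairs X B \<subseteq> separated_pairs X L" if "minimal_ancillary X \<Theta> P B" for B
    unfolding L(2) using that by (intro UN_upper) simp
  ultimately have "maximal_minimal_ancillary X \<Theta> P L"
    by (simp add: maximal_minimal_ancillary_iff)
  then show ?thesis by (rule exI[of _ L])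
qed

theorem proposition2:
  fixes X :: "'x measure" and \<Theta> :: "'t set" and P :: "'t \<Rightarrow> 'x measure"
  assumes "statistical_model X \<Theta> P"
    and "discrete_combinations X \<Theta> P"
    and "countably_many_ancillaries X \<Theta> P"
  shows "(\<forall>U. ancillary X \<Theta> P U \<longrightarrow>
            (stable_ancillary X \<Theta> P U \<longleftrightarrow> minimal_ancillary X \<Theta> P U) \<and>
            (strong_ancillary X \<Theta> P U \<longleftrightarrow> minimal_ancillary X \<Theta> P U)) \<and>
         (\<exists>L. maximal_minimal_ancillary X \<Theta> P L)"
proof -
  have P: "statistical_model X \<Theta> P"
    using assms(1) by (simp add: statistical_model_def statistical_model_def)
  show ?thesis
    using stable_ancillary_iff_pairs[OF P] strong_ancillary_iff_pairs[OF P]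
      minimal_ancillary_iff_pairs[OF P assms(2,3)] laminal_ancillary_exists[OF P assms(2,3)]
    by simp
qed

end
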